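(* Let $K\subseteq\overline{\mathbb{Q}}$ be a totally real field which is closed under square roots, and let $L$ be any totally imaginary quadratic extension of $K$. Then $\mathcal{O}_K$ is existentially definable in $\mathcal{O}_L$.
   Context: $\mathcal{O}_F$ is the ring of algebraic integers of a field $F$. A totally real field $K$ is closed under square roots if $\alpha\in K$ whenever $\alpha\in\overline{\mathbb{Q}}$ is totally real and $\alpha^2\in K$. A field is totally real if all its elements have only real conjugates; totally imaginary means having no embedding into $\mathbb{R}$. Existential definability is in the language of rings. *)

theory Defs
  imports "HOL-Algebra.Algebraic_Closure_Type" Complex_Main
begin

section \<open>Totally real and totally imaginary fields inside the complex numbers\<close>

abbreviation complex_field :: "complex ring" where
  "complex_field \<equiv> ring_of_type_algebra"

abbreviation real_field :: "real ring" where
  "real_field \<equiv> ring_of_type_algebra"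

definition algebraic_numbers :: "complex set" where
  "algebraic_numbers = {\<alpha>. algebraic \<alpha>}"

text \<open>An irreducible rational polynomial with root \<open>\<alpha>\<close> is, up to a unit, the minimal polynomial
  of \<open>\<alpha>\<close>. A transcendental number has no conjugates in this sense.\<close>

definition conjugate_over_rat :: "complex \<Rightarrow> complex \<Rightarrow> bool" where
  "conjugate_over_rat \<alpha> \<beta> \<longleftrightarrow>
     (\<exists>p :: rat poly. Factorial_Ring.irreducible p \<and>
        poly (map_poly of_rat p) \<alpha> = 0 \<and> poly (map_poly of_rat p) \<beta> = 0)"

definition totally_real :: "complex \<Rightarrow> bool" where
  "totally_real \<alpha> \<longleftrightarrow> algebraic \<alpha> \<and> (\<forall>\<beta>. conjugate_over_rat \<alpha> \<beta> \<longrightarrow> \<beta> \<in> \<real>)"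

definition totally_real_field :: "complex set \<Rightarrow> bool" where
  "totally_real_field K \<longleftrightarrow> subfield K complex_field \<and> (\<forall>\<alpha>\<in>K. totally_real \<alpha>)"

definition closed_under_square_roots :: "complex set \<Rightarrow> bool" where
  "closed_under_square_roots K \<longleftrightarrow>
     (\<forall>\<alpha>\<in>algebraic_numbers. totally_real \<alpha> \<and> \<alpha>\<^sup>2 \<in> K \<longrightarrow> \<alpha> \<in> K)"

text \<open>Unital ring homomorphisms out of a field into a nonzero ring are injective, so
  \<open>ring_hom\<close> below collects exactly the embeddings of \<open>L\<close> into the reals.\<close>

definition totally_imaginary_field :: "complex set \<Rightarrow> bool" where
  "totally_imaginary_field L \<longleftrightarrow>
     subfield L complex_field \<and> ring_hom (complex_field\<lparr>carrier := L\<rparr>) real_field = {}"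

definition quadratic_extension :: "complex set \<Rightarrow> complex set \<Rightarrow> bool" where
  "quadratic_extension K L \<longleftrightarrow>
     subfield K complex_field \<and> subfield L complex_field \<and> K \<subseteq> L \<and>
     ring.dimension complex_field 2 K L"

definition ring_of_integers :: "complex set \<Rightarrow> complex set" where
  "ring_of_integers F = {x \<in> F. algebraic_int x}"

definition integer_ring :: "complex set \<Rightarrow> complex ring" where
  "integer_ring F = complex_field\<lparr>carrier := ring_of_integers F\<rparr>"


section \<open>First-order formulas in the language of rings\<close>

datatype rterm =
    RVar nat | RZero | ROne | RNeg rterm | RAdd rterm rterm | RMul rterm rterm

datatype rformula =
    REq rterm rterm | RNot rformula | RAnd rformula rformula | ROr rformula rformula
  | REx nat rformula | RAll nat rformula

primrec term_val :: "('a, 'm) ring_scheme \<Rightarrow> (nat \<Rightarrow> 'a) \<Rightarrow> rterm \<Rightarrow> 'a" where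
  "term_val R e (RVar i) = e i"
| "term_val R e RZero = \<zero>\<^bsub>R\<^esub>"
| "term_val R e ROne = \<one>\<^bsub>R\<^esub>"
| "term_val R e (RNeg t) = \<ominus>\<^bsub>R\<^esub> term_val R e t"
| "term_val R e (RAdd s t) = term_val R e s \<oplus>\<^bsub>R\<^esub> term_val R e t"
| "term_val R e (RMul s t) = term_val R e s \<otimes>\<^bsub>R\<^esub> term_val R e t"

primrec holds :: "('a, 'm) ring_scheme \<Rightarrow> (nat \<Rightarrow> 'a) \<Rightarrow> rformula \<Rightarrow> bool" where
  "holds R e (REq s t) \<longleftrightarrow> term_val R e s = term_val R e t"
| "holds R e (RNot \<phi>) \<longleftrightarrow> \<not> holds R e \<phi>"
| "holds R e (RAnd \<phi> \<psi>) \<longleftrightarrow> holds R e \<phi> \<and> holds R e \<psi>"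
| "holds R e (ROr \<phi> \<psi>) \<longleftrightarrow> holds R e \<phi> \<or> holds R e \<psi>"
| "holds R e (REx i \<phi>) \<longleftrightarrow> (\<exists>a\<in>carrier R. holds R (e(i := a)) \<phi>)"
| "holds R e (RAll i \<phi>) \<longleftrightarrow> (\<forall>a\<in>carrier R. holds R (e(i := a)) \<phi>)"

primrec term_vars :: "rterm \<Rightarrow> nat set" where
  "term_vars (RVar i) = {i}"
| "term_vars RZero = {}"
| "term_vars ROne = {}"
| "term_vars (RNeg t) = term_vars t"
| "term_vars (RAdd s t) = term_vars s \<union> term_vars t"
| "term_vars (RMul s t) = term_vars s \<union> term_vars t"

primrec free_vars :: "rformula \<Rightarrow> nat set" where
  "free_vars (REq s t) = term_vars s \<union> term_vars t"
| "free_vars (RNot \<phi>) = free_vars \<phi>"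
| "free_vars (RAnd \<phi> \<psi>) = free_vars \<phi> \<union> free_vars \<psi>"
| "free_vars (ROr \<phi> \<psi>) = free_vars \<phi> \<union> free_vars \<psi>"
| "free_vars (REx i \<phi>) = free_vars \<phi> - {i}"
| "free_vars (RAll i \<phi>) = free_vars \<phi> - {i}"

primrec quantifier_free :: "rformula \<Rightarrow> bool" where
  "quantifier_free (REq s t) \<longleftrightarrow> True"
| "quantifier_free (RNot \<phi>) \<longleftrightarrow> quantifier_free \<phi>"
| "quantifier_free (RAnd \<phi> \<psi>) \<longleftrightarrow> quantifier_free \<phi> \<and> quantifier_free \<psi>"
| "quantifier_free (ROr \<phi> \<psi>) \<longleftrightarrow> quantifier_free \<phi> \<and> quantifier_free \<psi>"
| "quantifier_free (REx i \<phi>) \<longleftrightarrow> False"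
| "quantifier_free (RAll i \<phi>) \<longleftrightarrow> False"

inductive existential :: "rformula \<Rightarrow> bool" where
  "quantifier_free \<phi> \<Longrightarrow> existential \<phi>"
| "existential \<phi> \<Longrightarrow> existential (REx i \<phi>)"

text \<open>Definability is without parameters: variable 0 is the only free variable allowed.
  Hence the values of the assignment at the other variables are irrelevant.\<close>

definition existentially_definable :: "('a, 'm) ring_scheme \<Rightarrow> 'a set \<Rightarrow> bool" where
  "existentially_definable R S \<longleftrightarrow>
     (\<exists>\<phi>. existential \<phi> \<and> free_vars \<phi> \<subseteq> {0} \<and> S = {x \<in> carrier R. holds R (\<lambda>_. x) \<phi>})"

end

theory Submission
  imports Defs "Jordan_Normal_Form.Char_Poly"
begin

text \<open>Closure under square roots forces \<open>L = K(\<i>)\<close>. If \<open>u = 1 + 4 s\<close> is a unit of the integers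
  of \<open>L\<close>, then \<open>\<theta> = (s - cnj s) / cnj u\<close> is an algebraic integer with \<open>1 + 4 \<theta> = u / cnj u\<close>; every
  conjugate of the latter has absolute value \<open>1\<close>, so every conjugate of \<open>\<theta>\<close> has absolute value at
  most \<open>1/2\<close> and \<open>\<theta> = 0\<close>. Hence units congruent to \<open>1\<close> modulo \<open>4\<close> lie in \<open>K\<close>. Conversely, for an
  integer \<open>x\<close> of \<open>K\<close> the square root of \<open>4 x\<^sup>2 + 1\<close> lies in \<open>K\<close>, and the square \<open>u\<close> of the unit
  \<open>2 x + sqrt (4 x\<^sup>2 + 1)\<close> is congruent to \<open>1\<close> modulo \<open>4\<close> with \<open>u + 1 / u = 2 + 16 x\<^sup>2\<close>. Since
  \<open>16 (x + 1)\<^sup>2 - 16 x\<^sup>2 = 16 (2 x + 1)\<close>, the integers of \<open>K\<close> are those \<open>x\<close> for which \<open>16 (2 x + 1)\<close> is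
  a difference of two such traces \<open>u + 1 / u\<close>.\<close>

section \<open>Algebraic integers form a ring\<close>

text \<open>The additive group generated by \<open>W\<close>. The coefficients are a function on
  \<open>W\<close> without a support condition, so this reading is meant for finite
  \<open>W\<close>; over an infinite set the sum defaults to 0.\<close>

definition int_span :: "'a::field_char_0 set \<Rightarrow> 'a set" where
  "int_span W = {x. \<exists>c. x = (\<Sum>w\<in>W. of_int (c w) * w)}"

lemma int_spanI: "x = (\<Sum>w\<in>W. of_int (c w) * w) \<Longrightarrow> x \<in> int_span W"
  by (auto simp: int_span_def)

lemma int_span_generator:
  assumes "finite W" "w \<in> W"
  shows "w \<in> int_span W"
proof (rule int_spanI[where c = "\<lambda>v. if v = w then 1 else 0"])
  have "(\<Sum>v\<in>W. of_int (if v = w then 1 else 0) * v) = (\<Sum>v\<in>W. if v = w then v else 0)"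
    by (intro sum.cong) auto
  also have "\<dots> = w" using assms by simp
  finally show "w = (\<Sum>v\<in>W. of_int (if v = w then 1 else 0) * v)" by simp
qed

lemma int_span_0: "0 \<in> int_span W"
  by (rule int_spanI[where c = "\<lambda>_. 0"]) simp

lemma int_span_add:
  assumes "x \<in> int_span W" "y \<in> int_span W"
  shows "x + y \<in> int_span W"
proof -
  obtain c d where "x = (\<Sum>w\<in>W. of_int (c w) * w)" "y = (\<Sum>w\<in>W. of_int (d w) * w)"
    using assms by (auto simp: int_span_def)
  then show ?thesis
    by (intro int_spanI[where c = "\<lambda>w. c w + d w"]) (simp add: sum.distrib ring_distribs)
qed

lemma int_span_scale:
  assumes "x \<in> int_span W"
  shows "of_int k * x \<in> int_span W"
proof -
  obtain c where "x = (\<Sum>w\<in>W. of_int (c w) * w)"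
    using assms by (auto simp: int_span_def)
  then show ?thesis
    by (intro int_spanI[where c = "\<lambda>w. k * c w"]) (simp add: sum_distrib_left mult.assoc)
qed

lemma int_span_sum:
  "(\<And>i. i \<in> I \<Longrightarrow> f i \<in> int_span W) \<Longrightarrow> sum f I \<in> int_span W"
  by (induction I rule: infinite_finite_induct) (auto intro: int_span_0 int_span_add)

text \<open>By linearity, stability on generators passes to the whole span. Multiplications can then
  be composed, which is what products of algebraic integers need.\<close>

lemma int_span_mult:
  assumes "\<And>w. w \<in> W \<Longrightarrow> a * w \<in> int_span W" and "x \<in> int_span W"
  shows "a * x \<in> int_span W"
proof -
  obtain c where "x = (\<Sum>w\<in>W. of_int (c w) * w)"
    using assms by (auto simp: int_span_def)
  then have "a * x = (\<Sum>w\<in>W. of_int (c w) * (a * w))"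
    by (simp add: sum_distrib_left mult_ac)
  then show ?thesis
    using assms(1) by (auto intro!: int_span_sum int_span_scale)
qed

text \<open>The determinant trick: \<open>z\<close> is an eigenvalue of the integer matrix that describes
  multiplication by \<open>z\<close> on the generators.\<close>

lemma algebraic_int_if_stabilizes_int_span:
  fixes z :: "'a::field_char_0"
  assumes "finite W" "1 \<in> W" and stable: "\<And>w. w \<in> W \<Longrightarrow> z * w \<in> int_span W"
  shows "algebraic_int z"
proof -
  define k where "k = card W"
  obtain h where h: "bij_betw h {0..<k} W"
    using ex_bij_betw_nat_finite[OF \<open>finite W\<close>] k_def by blast
  have "\<forall>w\<in>W. \<exists>c. z * w = (\<Sum>v\<in>W. of_int (c v) * v)"
    using stable by (auto simp: int_span_def)
  then obtain c where c: "\<And>w. w \<in> W \<Longrightarrow> z * w = (\<Sum>v\<in>W. of_int (c w v) * v)"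
    by metis
  \<comment> \<open>Row \<open>i\<close> holds the coordinates of \<open>z * h i\<close>, so
    applying \<open>A\<close> to the column of generators multiplies that column by
    \<open>z\<close>.\<close>
  define A where "A = mat k k (\<lambda>(i, j). c (h i) (h j))"
  define v where "v = vec k h"
  have A: "A \<in> carrier_mat k k" by (simp add: A_def)
  have A': "map_mat (of_int :: int \<Rightarrow> 'a) A \<in> carrier_mat k k" using A by simp
  have eq: "map_mat of_int A *\<^sub>v v = z \<cdot>\<^sub>v v"
  proof (rule eq_vecI)
    fix i assume "i < dim_vec (z \<cdot>\<^sub>v v)"
    then have i: "i < k" by (simp add: v_def)
    then have "h i \<in> W" using h by (auto simp: bij_betw_def)
    have "(map_mat of_int A *\<^sub>v v) $ i = (\<Sum>j\<in>{0..<k}. of_int (c (h i) (h j)) * h j)"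
      using i by (simp add: A_def v_def scalar_prod_def)
    also have "\<dots> = (\<Sum>w\<in>W. of_int (c (h i) w) * w)"
      using h by (rule sum.reindex_bij_betw)
    also have "\<dots> = (z \<cdot>\<^sub>v v) $ i"
      using c[OF \<open>h i \<in> W\<close>] i by (simp add: v_def)
    finally show "(map_mat of_int A *\<^sub>v v) $ i = (z \<cdot>\<^sub>v v) $ i" .
  qed (simp add: A_def v_def)
  \<comment> \<open>The generator 1 gives \<open>v\<close> a nonzero entry, as an eigenvector must
    have.\<close>
  obtain i where i: "i < k" "h i = 1"
    using h \<open>1 \<in> W\<close> by (auto simp: bij_betw_def image_iff)
  then have "v $ i \<noteq> 0\<^sub>v k $ i" by (simp add: v_def)
  then have "v \<noteq> 0\<^sub>v k" by auto
  then have "eigenvector (map_mat of_int A) v z"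
    using eq by (simp add: eigenvector_def v_def A_def)
  then have "poly (char_poly (map_mat of_int A)) z = 0"
    using eigenvalue_root_char_poly[OF A'] by (auto simp: eigenvalue_def)
  then have "poly (map_poly of_int (char_poly A)) z = 0"
    using of_int_hom.char_poly_hom[OF A, where ?'a = 'a] by simp
  moreover have "lead_coeff (char_poly A) = 1"
    using degree_monic_char_poly[OF A] by simp
  ultimately show ?thesis
    by (auto simp: algebraic_int_altdef_ipoly)
qed

text \<open>Solve the monic integer equation for its top power.\<close>

lemma algebraic_int_power_reduce:
  fixes a :: "'a::field_char_0"
  assumes "algebraic_int a"
  obtains n and c :: "nat \<Rightarrow> int" where "n > 0" "a ^ n = (\<Sum>i<n. of_int (c i) * a ^ i)"
proof -
  obtain p where p: "poly (map_poly of_int p) a = 0" "lead_coeff p = 1"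
    using assms by (auto simp: algebraic_int_altdef_ipoly)
  define n where "n = degree p"
  have "(\<Sum>i\<le>n. of_int (coeff p i) * a ^ i) = 0"
    using p(1) by (simp add: poly_altdef n_def coeff_map_poly degree_map_poly)
  then have sum0: "(\<Sum>i<n. of_int (coeff p i) * a ^ i) + a ^ n = 0"
    using p(2) by (simp add: n_def lessThan_Suc_atMost[symmetric])
  show ?thesis
  proof (rule that[of n "\<lambda>i. - coeff p i"])
    \<comment> \<open>For \<open>n = 0\<close> the relation \<open>sum0\<close> would read 1 =
      0.\<close>
    show "n > 0" using sum0 by (cases n) auto
    show "a ^ n = (\<Sum>i<n. of_int (- coeff p i) * a ^ i)"
      using sum0 by (simp add: sum_negf eq_neg_iff_add_eq_0 add.commute)
  qed
qed

text \<open>The monomials \<open>a ^ i * b ^ j\<close> below both degrees generate Z[a, b]: a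
  product leaves the range only at the top exponent, where the monic relation rewrites it. One
  module stable under both numbers is stable under their sum and product.\<close>

lemma algebraic_int_common_span:
  fixes a b :: "'a::field_char_0"
  assumes "algebraic_int a" "algebraic_int b"
  obtains W where "finite W" "1 \<in> W"
    "\<And>w. w \<in> W \<Longrightarrow> a * w \<in> int_span W" "\<And>w. w \<in> W \<Longrightarrow> b * w \<in> int_span W"
proof -
  obtain n c where n: "n > 0" and c: "a ^ n = (\<Sum>i<n. of_int (c i) * a ^ i)"
    using assms(1) by (rule algebraic_int_power_reduce)
  obtain m d where m: "m > 0" and d: "b ^ m = (\<Sum>j<m. of_int (d j) * b ^ j)"
    using assms(2) by (rule algebraic_int_power_reduce)
  define W where "W = (\<lambda>(i, j). a ^ i * b ^ j) ` ({..<n} \<times> {..<m})"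
  have fin: "finite W" by (simp add: W_def)
  have gen: "a ^ i * b ^ j \<in> int_span W" if "i < n" "j < m" for i j
    using that by (intro int_span_generator[OF fin]) (auto simp: W_def)
  show ?thesis
  proof (rule that[OF fin])
    show "1 \<in> W" using n m by (auto simp: W_def intro!: image_eqI[where x = "(0, 0)"])
  next
    fix w assume "w \<in> W"
    then obtain i j where ij: "i < n" "j < m" "w = a ^ i * b ^ j" by (auto simp: W_def)
    show "a * w \<in> int_span W"
    proof (cases "Suc i < n")
      case True
      then show ?thesis using gen[of "Suc i" j] ij by (simp add: mult_ac)
    next
      case False
      then have "n = Suc i" using ij by simp
      then have "a * w = a ^ n * b ^ j" using ij by (simp add: mult_ac)
      also have "\<dots> = (\<Sum>i<n. of_int (c i) * (a ^ i * b ^ j))"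
        by (subst c) (simp add: sum_distrib_left mult_ac)
      finally show ?thesis using ij by (auto intro!: int_span_sum int_span_scale gen)
    qed
    show "b * w \<in> int_span W"
    proof (cases "Suc j < m")
      case True
      then show ?thesis using gen[of i "Suc j"] ij by (simp add: mult_ac)
    next
      case False
      then have "m = Suc j" using ij by simp
      then have "b * w = a ^ i * b ^ m" using ij by (simp add: mult_ac)
      also have "\<dots> = (\<Sum>j<m. of_int (d j) * (a ^ i * b ^ j))"
        by (subst d) (simp add: sum_distrib_left mult_ac)
      finally show ?thesis using ij by (auto intro!: int_span_sum int_span_scale gen)
    qed
  qed
qed

section \<open>Sums, products and differences of algebraic integers\<close>

lemma algebraic_int_add:
  fixes a b :: "'a::field_char_0"
  assumes "algebraic_int a" "algebraic_int b"
  shows "algebraic_int (a + b)"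
proof -
  obtain W where W: "finite W" "1 \<in> W" "\<And>w. w \<in> W \<Longrightarrow> a * w \<in> int_span W"
    "\<And>w. w \<in> W \<Longrightarrow> b * w \<in> int_span W"
    using algebraic_int_common_span[OF assms] by blast
  show ?thesis
    using W(1,2) by (rule algebraic_int_if_stabilizes_int_span)
      (simp add: distrib_right int_span_add W)
qed

lemma algebraic_int_mult:
  fixes a b :: "'a::field_char_0"
  assumes "algebraic_int a" "algebraic_int b"
  shows "algebraic_int (a * b)"
proof -
  obtain W where W: "finite W" "1 \<in> W" "\<And>w. w \<in> W \<Longrightarrow> a * w \<in> int_span W"
    "\<And>w. w \<in> W \<Longrightarrow> b * w \<in> int_span W"
    using algebraic_int_common_span[OF assms] by blast
  show ?thesis
    using W(1,2) by (rule algebraic_int_if_stabilizes_int_span)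
      (simp add: mult.assoc int_span_mult W)
qed

lemma algebraic_int_diff:
  fixes a b :: "'a::field_char_0"
  assumes "algebraic_int a" "algebraic_int b"
  shows "algebraic_int (a - b)"
  using algebraic_int_add[OF assms(1) algebraic_int_minus[OF assms(2)]] by simp

lemma algebraic_int_prod_mset:
  fixes A :: "'a::field_char_0 multiset"
  shows "(\<And>a. a \<in># A \<Longrightarrow> algebraic_int a) \<Longrightarrow> algebraic_int (prod_mset A)"
  by (induction A) (auto intro: algebraic_int_mult int_imp_algebraic_int)

section \<open>Extension of embeddings\<close>

text \<open>Field isomorphisms between subfields, represented by their graphs so that Zorn's lemma applies
  to set inclusion.\<close>

definition field_graph :: "('a::field \<times> 'b::field) set \<Rightarrow> bool" where
  "field_graph G \<longleftrightarrow>
     (1, 1) \<in> G \<and>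
     (\<forall>x y x' y'. (x, y) \<in> G \<longrightarrow> (x', y') \<in> G \<longrightarrow> (x - x', y - y') \<in> G \<and> (x * x', y * y') \<in> G) \<and>
     (\<forall>x y. (x, y) \<in> G \<longrightarrow> (inverse x, inverse y) \<in> G \<and> (x = 0 \<longleftrightarrow> y = 0))"

context
  fixes G :: "('a::field \<times> 'b::field) set"
  assumes G: "field_graph G"
begin

lemma field_graph_one: "(1, 1) \<in> G"
  and field_graph_diff: "(x, y) \<in> G \<Longrightarrow> (x', y') \<in> G \<Longrightarrow> (x - x', y - y') \<in> G"
  and field_graph_mult: "(x, y) \<in> G \<Longrightarrow> (x', y') \<in> G \<Longrightarrow> (x * x', y * y') \<in> G"
  and field_graph_inverse: "(x, y) \<in> G \<Longrightarrow> (inverse x, inverse y) \<in> G"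
  and field_graph_eq_0_iff: "(x, y) \<in> G \<Longrightarrow> x = 0 \<longleftrightarrow> y = 0"
  using G unfolding field_graph_def by blast+

lemma field_graph_zero: "(0, 0) \<in> G"
  using field_graph_diff[OF field_graph_one field_graph_one] by simp

lemma field_graph_uminus: "(x, y) \<in> G \<Longrightarrow> (- x, - y) \<in> G"
  using field_graph_diff[OF field_graph_zero] by fastforce

lemma field_graph_add: "(x, y) \<in> G \<Longrightarrow> (x', y') \<in> G \<Longrightarrow> (x + x', y + y') \<in> G"
  using field_graph_diff[OF _ field_graph_uminus] by fastforce

lemma field_graph_divide: "(x, y) \<in> G \<Longrightarrow> (x', y') \<in> G \<Longrightarrow> (x / x', y / y') \<in> G"
  using field_graph_mult[OF _ field_graph_inverse] by (simp add: divide_inverse)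

lemma field_graph_sum: "(\<And>i. i \<in> I \<Longrightarrow> (f i, g i) \<in> G) \<Longrightarrow> (sum f I, sum g I) \<in> G"
  by (induction I rule: infinite_finite_induct) (auto intro: field_graph_zero field_graph_add)

text \<open>Preservation of zero, applied to a difference, makes the relation single valued; the
  zero clause of \<open>field_graph\<close> thus encodes functionality.\<close>

lemma field_graph_unique:
  assumes "(x, y) \<in> G" "(x, y') \<in> G"
  shows "y = y'"
  using field_graph_eq_0_iff[OF field_graph_diff[OF assms]] by simp

lemma field_graph_of_nat: "(of_nat n, of_nat n) \<in> G"
  by (induction n) (auto intro: field_graph_zero field_graph_one field_graph_add)

lemma field_graph_of_int: "(of_int k, of_int k) \<in> G"
  using field_graph_of_nat field_graph_uminus by (cases k rule: int_diff_cases)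
    (auto intro: field_graph_diff)

section \<open>Polynomials that correspond under a field isomorphism\<close>

text \<open>Says that \<open>q\<close> is \<open>p\<close> transported along the isomorphism, and at
  the same time that the coefficients of \<open>p\<close> lie in its domain.\<close>

definition coeffs_related :: "'a poly \<Rightarrow> 'b poly \<Rightarrow> bool" where
  "coeffs_related p q \<longleftrightarrow> (\<forall>i. (coeff p i, coeff q i) \<in> G)"

lemma coeffs_related_diff:
  "coeffs_related p q \<Longrightarrow> coeffs_related p' q' \<Longrightarrow> coeffs_related (p - p') (q - q')"
  by (simp add: coeffs_related_def field_graph_diff)

lemma coeffs_related_add:
  "coeffs_related p q \<Longrightarrow> coeffs_related p' q' \<Longrightarrow> coeffs_related (p + p') (q + q')"
  by (simp add: coeffs_related_def field_graph_add)

lemma coeffs_related_mult: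
  "coeffs_related p q \<Longrightarrow> coeffs_related p' q' \<Longrightarrow> coeffs_related (p * p') (q * q')"
  by (simp add: coeffs_related_def coeff_mult field_graph_sum field_graph_mult)

lemma coeffs_related_monom: "(x, y) \<in> G \<Longrightarrow> coeffs_related (monom x n) (monom y n)"
  by (simp add: coeffs_related_def field_graph_zero)

lemma coeffs_related_const: "(x, y) \<in> G \<Longrightarrow> coeffs_related [:x:] [:y:]"
  using coeffs_related_monom[of x y 0] by (simp add: monom_0)

lemma coeffs_related_coeff_eq_0_iff: "coeffs_related p q \<Longrightarrow> coeff p i = 0 \<longleftrightarrow> coeff q i = 0"
  using field_graph_eq_0_iff by (auto simp: coeffs_related_def)

lemma coeffs_related_eq_0_iff: "coeffs_related p q \<Longrightarrow> p = 0 \<longleftrightarrow> q = 0"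
  by (simp add: poly_eq_iff coeffs_related_coeff_eq_0_iff)

lemma coeffs_related_degree: "coeffs_related p q \<Longrightarrow> degree p = degree q"
  by (simp add: degree_def coeffs_related_coeff_eq_0_iff)

text \<open>Long division is run on both sides in parallel, so that quotients and remainders stay
  related.\<close>

lemma coeffs_related_division:
  assumes "coeffs_related f g" "coeffs_related p q" "p \<noteq> 0"
  obtains k l r s where "coeffs_related k l" "coeffs_related r s"
    "f = p * k + r" "g = q * l + s" "r = 0 \<or> degree r < degree p"
proof -
  have "q \<noteq> 0" using assms coeffs_related_eq_0_iff by blast
  have deg_pq: "degree p = degree q" using assms by (simp add: coeffs_related_degree)
  have "\<exists>k l r s. coeffs_related k l \<and> coeffs_related r s \<and>
    f = p * k + r \<and> g = q * l + s \<and> (r = 0 \<or> degree r < degree p)"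
    using assms(1)
  \<comment> \<open>The measure separates 0 from nonzero constants, both of which have degree
    0.\<close>
  proof (induction "if f = 0 then 0 else Suc (degree f)" arbitrary: f g rule: less_induct)
    case less
    show ?case
    proof (cases "f = 0 \<or> degree f < degree p")
      case True
      then show ?thesis
        using less.prems coeffs_related_const[OF field_graph_zero]
        by (intro exI[of _ 0] exI[of _ f] exI[of _ g]) auto
    next
      case False
      \<comment> \<open>The monomial \<open>monom c n\<close> is chosen so that \<open>p\<close>
        times it cancels the leading term of \<open>f\<close>; \<open>monom d n\<close> does the
        same for \<open>g\<close>.\<close>
      define n where "n = degree f - degree p"
      define c where "c = lead_coeff f / lead_coeff p"
      define d where "d = lead_coeff g / lead_coeff q"
      have deg_fg: "degree f = degree g" using less.prems by (rule coeffs_related_degree)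
      have cd: "coeffs_related (monom c n) (monom d n)"
        using less.prems assms(2) deg_fg deg_pq unfolding c_def d_def
        by (intro coeffs_related_monom field_graph_divide) (auto simp: coeffs_related_def)
      define f' where "f' = f - p * monom c n"
      define g' where "g' = g - q * monom d n"
      have rel': "coeffs_related f' g'"
        unfolding f'_def g'_def
        by (intro coeffs_related_diff coeffs_related_mult less.prems assms(2) cd)
      have "c \<noteq> 0" using False \<open>p \<noteq> 0\<close> by (simp add: c_def)
      have "degree (p * monom c n) = degree f"
        using False \<open>p \<noteq> 0\<close> \<open>c \<noteq> 0\<close> by (simp add: degree_mult_eq degree_monom_eq n_def)
      then have "degree f' \<le> degree f"
        unfolding f'_def by (simp add: degree_diff_le)
      moreover have "coeff f' (degree f) = 0"
      proof -
        have "coeff (p * monom c n) (degree p + n) = lead_coeff p * c"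
          using coeff_mult_degree_sum[of p "monom c n"] \<open>c \<noteq> 0\<close> by (simp add: degree_monom_eq)
        then show ?thesis using False \<open>p \<noteq> 0\<close> by (simp add: f'_def n_def c_def)
      qed
      ultimately have "f' = 0 \<or> degree f' < degree f"
        by (metis leading_coeff_0_iff nat_less_le)
      then have smaller: "(if f' = 0 then 0 else Suc (degree f')) < (if f = 0 then 0 else Suc (degree f))"
        using False by auto
      obtain k l r s where "coeffs_related k l" "coeffs_related r s" "f' = p * k + r"
        "g' = q * l + s" "r = 0 \<or> degree r < degree p"
        using less.hyps[OF smaller rel'] by blast
      then have "coeffs_related (monom c n + k) (monom d n + l) \<and> coeffs_related r s \<and>
        f = p * (monom c n + k) + r \<and> g = q * (monom d n + l) + s \<and> (r = 0 \<or> degree r < degree p)"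
        using cd by (auto simp: f'_def g'_def algebra_simps intro: coeffs_related_add)
      then show ?thesis by blast
    qed
  qed
  then show ?thesis using that by blast
qed

text \<open>Here \<open>p\<close> acts as minimal polynomial of \<alpha> over the domain field and
  \<open>q\<close> is its transport. Sending each value \<open>poly f \<alpha>\<close> to
  \<open>poly g \<beta>\<close> for related \<open>f\<close>, \<open>g\<close> is then the classical
  isomorphism of simple extensions.\<close>

lemma field_graph_adjoin:
  assumes pq: "coeffs_related p q" and p0: "p \<noteq> 0" and roots: "poly p \<alpha> = 0" "poly q \<beta> = 0"
    and minimal: "\<And>f g. coeffs_related f g \<Longrightarrow> f \<noteq> 0 \<Longrightarrow> poly f \<alpha> = 0 \<Longrightarrow> degree p \<le> degree f"
  obtains H where "field_graph H" "G \<subseteq> H" "(\<alpha>, \<beta>) \<in> H"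
proof -
  have small_root: "r = 0" if "coeffs_related r s" "r = 0 \<or> degree r < degree p" "poly r \<alpha> = 0" for r s
    using minimal[OF that(1)] that by fastforce
  \<comment> \<open>Well-definedness: by minimality \<open>p\<close> divides every \<open>f\<close>
    that vanishes at \<alpha>, and the parallel division shows that \<open>q\<close> divides
    \<open>g\<close>.\<close>
  have root: "poly g \<beta> = 0" if fg: "coeffs_related f g" and "poly f \<alpha> = 0" for f g
  proof -
    obtain k l r s where "coeffs_related r s" "f = p * k + r" "g = q * l + s" "r = 0 \<or> degree r < degree p"
      using coeffs_related_division[OF fg pq p0] by metis
    moreover from this have "r = 0" using roots that(2) small_root by simp
    ultimately have "s = 0" using coeffs_related_eq_0_iff by blast
    then show ?thesis using \<open>g = q * l + s\<close> roots by simp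
  qed
  have inv: "\<exists>k l. coeffs_related k l \<and> poly f \<alpha> * poly k \<alpha> = 1"
    if fg: "coeffs_related f g" and f: "poly f \<alpha> \<noteq> 0" for f g
  proof -
    \<comment> \<open>In place of the Euclidean algorithm: among polynomials whose nonzero value at
      \<alpha> is a multiple of \<open>poly f \<alpha>\<close>, one of least degree will turn out to
      be constant, and dividing by that constant inverts \<open>poly f \<alpha>\<close>.\<close>
    define M where "M = (\<lambda>h. poly h \<alpha> \<noteq> 0 \<and> (\<exists>h'. coeffs_related h h') \<and>
      (\<exists>k l. coeffs_related k l \<and> poly h \<alpha> = poly f \<alpha> * poly k \<alpha>))"
    obtain k l r s where kl: "coeffs_related k l" "coeffs_related r s" "f = p * k + r"
      "r = 0 \<or> degree r < degree p"
      using coeffs_related_division[OF fg pq p0] by metis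
    have "poly r \<alpha> = poly f \<alpha> * poly 1 \<alpha>" using kl(3) roots by simp
    moreover have "coeffs_related 1 1"
      using coeffs_related_const[OF field_graph_one] by (simp add: one_pCons)
    ultimately have "M r" using kl f unfolding M_def by auto
    then obtain h where h: "M h" and least: "\<And>h'. M h' \<Longrightarrow> degree h \<le> degree h'"
      using ex_has_least_nat[of M r degree] by blast
    have "degree h < degree p"
    proof -
      have "r \<noteq> 0" using \<open>M r\<close> by (auto simp: M_def)
      then show ?thesis using kl(4) least[OF \<open>M r\<close>] by simp
    qed
    obtain h' k l where h': "coeffs_related h h'" and kl: "coeffs_related k l"
      and hk: "poly h \<alpha> = poly f \<alpha> * poly k \<alpha>" and h\<alpha>: "poly h \<alpha> \<noteq> 0"
      using h by (auto simp: M_def)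
    have "h \<noteq> 0" using h\<alpha> by auto
    obtain a b c d where ab: "coeffs_related a b" and cd: "coeffs_related c d"
      and div: "p = h * a + c" "c = 0 \<or> degree c < degree h"
      using coeffs_related_division[OF pq h' \<open>h \<noteq> 0\<close>] by metis
    \<comment> \<open>The remainder of \<open>p\<close> modulo \<open>h\<close> has as value again a
      multiple of \<open>poly f \<alpha>\<close>, so a nonzero value would contradict the least
      degree of \<open>h\<close>.\<close>
    have "poly c \<alpha> = 0"
    proof (rule ccontr)
      assume "poly c \<alpha> \<noteq> 0"
      have "poly c \<alpha> = poly f \<alpha> * poly (0 - k * a) \<alpha>"
        using arg_cong[OF div(1), of "\<lambda>p. poly p \<alpha>"] roots hk
        by (simp add: eq_neg_iff_add_eq_0 algebra_simps)
      moreover have "coeffs_related (0 - k * a) (0 - l * b)"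
        using coeffs_related_const[OF field_graph_zero]
        by (intro coeffs_related_diff coeffs_related_mult kl ab) simp
      ultimately have "M c" using \<open>poly c \<alpha> \<noteq> 0\<close> cd unfolding M_def by blast
      then show False using least[OF \<open>M c\<close>] div(2) \<open>poly c \<alpha> \<noteq> 0\<close> by auto
    qed
    then have "c = 0" using small_root[OF cd] div(2) \<open>degree h < degree p\<close> by auto
    then have "p = h * a" "a \<noteq> 0" using div p0 by auto
    then have "poly a \<alpha> = 0" using roots h\<alpha> by simp
    \<comment> \<open>The cofactor \<open>a\<close> vanishes at \<alpha>, so it takes up the whole
      degree of \<open>p\<close> and leaves \<open>h\<close> constant.\<close>
    then have "degree p \<le> degree a" using minimal[OF ab \<open>a \<noteq> 0\<close>] by simp
    then have "degree h = 0" using \<open>p = h * a\<close> \<open>h \<noteq> 0\<close> \<open>a \<noteq> 0\<close> by (simp add: degree_mult_eq)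
    then obtain e where e: "h = [:e:]" by (rule degree_eq_zeroE)
    have "(coeff h 0, coeff h' 0) \<in> G" using h' by (simp add: coeffs_related_def)
    then have "coeffs_related (k * [:inverse e:]) (l * [:inverse (coeff h' 0):])"
      using e by (intro coeffs_related_mult kl coeffs_related_const field_graph_inverse) simp
    moreover have "poly f \<alpha> * poly (k * [:inverse e:]) \<alpha> = 1"
      using hk e h\<alpha> by (simp add: field_simps)
    ultimately show ?thesis by blast
  qed
  have inv': "\<exists>k l. coeffs_related k l \<and> poly f \<alpha> * poly k \<alpha> = 1 \<and> poly g \<beta> * poly l \<beta> = 1"
    if fg: "coeffs_related f g" and f: "poly f \<alpha> \<noteq> 0" for f g
  proof -
    obtain k l where kl: "coeffs_related k l" "poly f \<alpha> * poly k \<alpha> = 1"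
      using inv[OF fg f] by blast
    \<comment> \<open>The product \<open>f * k\<close> minus 1 vanishes at \<alpha>, so
      \<open>root\<close> carries the inverse relation over to \<beta>.\<close>
    have "coeffs_related (f * k - [:1:]) (g * l - [:1:])"
      by (intro coeffs_related_diff coeffs_related_mult fg kl coeffs_related_const field_graph_one)
    then have "poly (g * l - [:1:]) \<beta> = 0" by (rule root) (simp add: kl)
    then show ?thesis using kl by auto
  qed
  define H where "H = {(poly f \<alpha>, poly g \<beta>) | f g. coeffs_related f g}"
  have HI: "(poly f \<alpha>, poly g \<beta>) \<in> H" if "coeffs_related f g" for f g
    using that by (auto simp: H_def)
  have "G \<subseteq> H"
    using HI[OF coeffs_related_const] by auto
  moreover have "(\<alpha>, \<beta>) \<in> H"
    using HI[OF coeffs_related_monom[OF field_graph_one, of 1]] by (simp add: poly_monom)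
  moreover have "field_graph H"
    unfolding field_graph_def
  proof (intro conjI allI impI)
    show "(1, 1) \<in> H" using \<open>G \<subseteq> H\<close> field_graph_one by blast
  next
    fix x y x' y' assume "(x, y) \<in> H" "(x', y') \<in> H"
    then obtain f g f' g' where "coeffs_related f g" "coeffs_related f' g'"
      and [simp]: "x = poly f \<alpha>" "y = poly g \<beta>" "x' = poly f' \<alpha>" "y' = poly g' \<beta>"
      by (auto simp: H_def)
    then show "(x - x', y - y') \<in> H" "(x * x', y * y') \<in> H"
      using HI[OF coeffs_related_diff[of f g f' g']] HI[OF coeffs_related_mult[of f g f' g']] by auto
  next
    fix x y assume "(x, y) \<in> H"
    then obtain f g where fg: "coeffs_related f g" and [simp]: "x = poly f \<alpha>" "y = poly g \<beta>"
      by (auto simp: H_def)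
    show iff: "x = 0 \<longleftrightarrow> y = 0"
      using root[OF fg] inv'[OF fg] by fastforce
    show "(inverse x, inverse y) \<in> H"
    proof (cases "x = 0")
      case True
      then show ?thesis using iff \<open>(x, y) \<in> H\<close> by simp
    next
      case False
      then obtain k l where "coeffs_related k l" "x * poly k \<alpha> = 1" "y * poly l \<beta> = 1"
        using inv'[OF fg] by auto
      then show ?thesis using HI by (metis inverse_unique)
    qed
  qed
  ultimately show ?thesis using that by blast
qed

end

section \<open>Rational polynomials, and extension of isomorphisms to all algebraic numbers\<close>

lemma field_graph_of_rat:
  fixes G :: "('a::field_char_0 \<times> 'b::field_char_0) set"
  assumes "field_graph G"
  shows "(of_rat q, of_rat q) \<in> G"
  by (cases q) (simp add: of_rat_rat assms field_graph_divide field_graph_of_int)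

lemma field_graph_poly:
  fixes G :: "('a::field_char_0 \<times> 'b::field_char_0) set"
  assumes G: "field_graph G" and xy: "(x, y) \<in> G"
  shows "(poly (map_poly of_rat p) x, poly (map_poly of_rat p) y) \<in> G"
proof (induction p)
  case 0
  then show ?case using field_graph_zero[OF G] by simp
next
  case (pCons c p)
  then show ?case
    by (simp add: map_poly_pCons field_graph_add[OF G] field_graph_mult[OF G] field_graph_of_rat[OF G] xy)
qed

lemma field_graph_poly_root_iff:
  fixes G :: "('a::field_char_0 \<times> 'b::field_char_0) set"
  assumes "field_graph G" "(x, y) \<in> G"
  shows "poly (map_poly of_rat p) x = 0 \<longleftrightarrow> poly (map_poly of_rat p) y = 0"
  using field_graph_eq_0_iff[OF assms(1) field_graph_poly[OF assms]] .

lemma field_graph_rat: "field_graph (range (\<lambda>q. (of_rat q :: 'a::field_char_0, of_rat q :: 'b::field_char_0)))"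
  unfolding field_graph_def
proof (intro conjI allI impI)
  show "(1, 1) \<in> range (\<lambda>q. (of_rat q :: 'a, of_rat q :: 'b))"
    by (rule range_eqI[of _ _ 1]) simp
qed (auto simp flip: of_rat_diff of_rat_mult of_rat_inverse)

lemma algebraic_rat_poly:
  fixes x :: "'a::field_char_0"
  assumes "algebraic x"
  obtains p :: "rat poly" where "p \<noteq> 0" "poly (map_poly of_rat p) x = 0"
proof -
  obtain p where p: "p \<noteq> 0" "poly (map_poly of_int p) x = 0"
    using assms by (rule algebraicE')
  show ?thesis
    by (rule that[of "map_poly of_int p"])
      (use p in \<open>auto simp: map_poly_map_poly o_def map_poly_eq_0_iff\<close>)
qed

text \<open>A maximal extension exists by Zorn's lemma. It reaches every algebraic number, since
  otherwise one more could be adjoined, its image being a complex root of the transported minimal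
  polynomial.\<close>

lemma field_graph_extend_algebraic:
  fixes G :: "(complex \<times> complex) set"
  assumes "field_graph G"
  obtains H where "field_graph H" "G \<subseteq> H" "Collect algebraic \<subseteq> Domain H"
proof -
  define Ext where "Ext = {H. field_graph H \<and> G \<subseteq> H}"
  have "\<exists>M\<in>Ext. \<forall>Y\<in>Ext. M \<subseteq> Y \<longrightarrow> Y = M"
  proof (rule subset_Zorn_nonempty)
    show "Ext \<noteq> {}" using assms by (auto simp: Ext_def)
  next
    fix C assume C: "C \<noteq> {}" "subset.chain Ext C"
    have graph: "field_graph Y" "G \<subseteq> Y" if "Y \<in> C" for Y
      using C that by (auto simp: Ext_def subset.chain_def)
    \<comment> \<open>Two pairs in the union already lie in one member of the chain, so closure can
      be checked there.\<close>
    have common: "\<exists>Y\<in>C. u \<in> Y \<and> v \<in> Y" if uv: "u \<in> \<Union>C" "v \<in> \<Union>C" for u v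
      proof -
      obtain Y Y' where Y: "Y \<in> C" "u \<in> Y" "Y' \<in> C" "v \<in> Y'"
        using uv by blast
      then have "Y \<subseteq> Y' \<or> Y' \<subseteq> Y"
        using C(2) by (auto simp: subset_chain_def)
      then show ?thesis using Y by blast
    qed
    have "field_graph (\<Union>C)"
      unfolding field_graph_def
    proof (intro conjI allI impI)
      show "(1, 1) \<in> \<Union>C"
        using C(1) graph field_graph_one by blast
    next
      fix x y x' y' assume "(x, y) \<in> \<Union>C" "(x', y') \<in> \<Union>C"
      then obtain Y where Y: "Y \<in> C" "(x, y) \<in> Y" "(x', y') \<in> Y"
        using common by blast
      have "(x - x', y - y') \<in> Y" "(x * x', y * y') \<in> Y"
        using field_graph_diff[OF graph(1)[OF Y(1)] Y(2,3)]
          field_graph_mult[OF graph(1)[OF Y(1)] Y(2,3)] .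
      then show "(x - x', y - y') \<in> \<Union>C" "(x * x', y * y') \<in> \<Union>C"
        using Y(1) by auto
    next
      fix x y assume "(x, y) \<in> \<Union>C"
      then obtain Y where Y: "Y \<in> C" "(x, y) \<in> Y" by blast
      show "(inverse x, inverse y) \<in> \<Union>C" "x = 0 \<longleftrightarrow> y = 0"
        using field_graph_inverse[OF graph(1)[OF Y(1)] Y(2)]
          field_graph_eq_0_iff[OF graph(1)[OF Y(1)] Y(2)] Y(1) by auto
    qed
    then show "\<Union>C \<in> Ext" using C graph by (auto simp: Ext_def)
  qed
  then obtain H where H: "field_graph H" "G \<subseteq> H"
    and maximal: "\<And>Y. field_graph Y \<Longrightarrow> H \<subseteq> Y \<Longrightarrow> Y = H"
    by (force simp: Ext_def)
  have "\<alpha> \<in> Domain H" if "algebraic \<alpha>" for \<alpha>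
  proof -
    \<comment> \<open>A polynomial of least degree in \<open>R\<close> serves as minimal polynomial
      of \<alpha> over the domain of \<open>H\<close>; the rational annihilator shows that
      \<open>R\<close> is inhabited.\<close>
    define R where "R = (\<lambda>f. f \<noteq> 0 \<and> poly f \<alpha> = 0 \<and> (\<exists>g. coeffs_related H f g))"
    obtain h :: "rat poly" where h: "h \<noteq> 0" "poly (map_poly of_rat h) \<alpha> = 0"
      using \<open>algebraic \<alpha>\<close> by (rule algebraic_rat_poly)
    have "coeffs_related H (map_poly of_rat h) (map_poly of_rat h)"
      by (simp add: coeffs_related_def[OF H(1)] coeff_map_poly field_graph_of_rat[OF H(1)])
    then have "R (map_poly of_rat h)"
      using h by (auto simp: R_def map_poly_eq_0_iff)
    then obtain p where p: "R p" and least: "\<And>f. R f \<Longrightarrow> degree p \<le> degree f"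
      using ex_has_least_nat[of R _ degree] by blast
    then obtain q where pq: "coeffs_related H p q" and p0: "p \<noteq> 0" and root: "poly p \<alpha> = 0"
      by (auto simp: R_def)
    have "degree p \<noteq> 0"
      using p0 root by (auto elim!: degree_eq_zeroE)
    then have "degree q \<noteq> 0" using coeffs_related_degree[OF H(1) pq] by simp
    then obtain \<beta> where \<beta>: "poly q \<beta> = 0"
      using fundamental_theorem_of_algebra[of q] by (auto simp: constant_degree)
    have "degree p \<le> degree f" if "coeffs_related H f g" "f \<noteq> 0" "poly f \<alpha> = 0" for f g
      using that by (intro least) (auto simp: R_def)
    then obtain Y where "field_graph Y" "H \<subseteq> Y" "(\<alpha>, \<beta>) \<in> Y"
      by (rule field_graph_adjoin[OF H(1) pq p0 root \<beta>])
    then show ?thesis using maximal by blast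
  qed
  then show ?thesis using that[OF H] by blast
qed

section \<open>Conjugates and embeddings\<close>

text \<open>If \<open>m\<close> did not divide \<open>h\<close>, the two would be coprime, and a
  Bezout identity evaluated at the common root \<open>x\<close> would give 0 = 1.\<close>

lemma irreducible_rat_poly_degree_le:
  fixes x :: "'a::field_char_0" and m :: "rat poly"
  assumes m: "Factorial_Ring.irreducible m" "poly (map_poly of_rat m) x = 0"
    and h: "h \<noteq> 0" "poly (map_poly of_rat h) x = 0"
  shows "degree m \<le> degree h"
proof -
  have "m dvd h"
  proof (rule ccontr)
    interpret map_poly_comm_ring_hom "of_rat :: rat \<Rightarrow> 'a" ..
    assume "\<not> m dvd h"
    then have "gcd m h = 1"
      using m(1) by (simp add: irreducible_imp_prime_elem_gcd prime_elem_imp_coprime)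
    then obtain u v where "u * m + v * h = 1"
      using bezout_coefficients_fst_snd[of m h] by metis
    then have "poly (map_poly of_rat (u * m + v * h)) x = 1" by simp
    then show False using m(2) h(2) by (simp add: hom_add hom_mult)
  qed
  then show ?thesis using h(1) by (rule dvd_imp_degree_le)
qed


text \<open>Start from the identity on the rationals, adjoin \<alpha> with image \<beta>, then
  extend. The domain clause gives every algebraic number an image under the same embedding.\<close>

lemma embedding_to_conjugate:
  assumes "conjugate_over_rat \<alpha> \<beta>"
  obtains G :: "(complex \<times> complex) set"
  where "field_graph G" "(\<alpha>, \<beta>) \<in> G" "Collect algebraic \<subseteq> Domain G"
proof -
  obtain m :: "rat poly" where m: "Factorial_Ring.irreducible m"
    "poly (map_poly of_rat m) \<alpha> = 0" "poly (map_poly of_rat m) \<beta> = 0"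
    using assms by (auto simp: conjugate_over_rat_def)
  define G where "G = range (\<lambda>q. (of_rat q :: complex, of_rat q :: complex))"
  have G: "field_graph G" unfolding G_def by (rule field_graph_rat)
  \<comment> \<open>Polynomials over the domain of \<open>G\<close> are rational, so minimality
    there is minimality over the rationals.\<close>
  have rational: "\<exists>h. f = map_poly of_rat h" if "coeffs_related G f g" for f g
  proof -
    have "coeff f i \<in> \<rat>" for i
    proof -
      have "(coeff f i, coeff g i) \<in> G"
        using that by (simp add: coeffs_related_def[OF G])
      then show ?thesis by (auto simp: G_def)
    qed
    then show ?thesis using ratpolyE by blast
  qed
  have "\<exists>H. field_graph H \<and> G \<subseteq> H \<and> (\<alpha>, \<beta>) \<in> H"
  proof (rule field_graph_adjoin[OF G _ _ m(2,3)])
    show "coeffs_related G (map_poly of_rat m) (map_poly of_rat m)"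
      by (simp add: coeffs_related_def[OF G] coeff_map_poly field_graph_of_rat[OF G])
    show "map_poly of_rat m \<noteq> (0 :: complex poly)"
      using m(1) by (auto simp: map_poly_eq_0_iff)
  next
    fix f g assume "coeffs_related G f g" "f \<noteq> 0" "poly f \<alpha> = 0"
    then obtain h where "f = map_poly of_rat h" using rational by blast
    moreover from this have "h \<noteq> 0" using \<open>f \<noteq> 0\<close> by auto
    ultimately show "degree (map_poly of_rat m :: complex poly) \<le> degree f"
      using irreducible_rat_poly_degree_le[OF m(1,2)] \<open>poly f \<alpha> = 0\<close>
      by (simp add: degree_map_poly)
  qed blast
  then obtain H where H: "field_graph H" "(\<alpha>, \<beta>) \<in> H" by blast
  obtain I where I: "field_graph I" "H \<subseteq> I" "Collect algebraic \<subseteq> Domain I"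
    by (rule field_graph_extend_algebraic[OF H(1)])
  show ?thesis using H(2) I(2) by (intro that[OF I(1) _ I(3)]) auto
qed

lemma algebraic_irreducible_poly:
  fixes x :: "'a::field_char_0"
  assumes "algebraic x"
  obtains m :: "rat poly" where "Factorial_Ring.irreducible m" "poly (map_poly of_rat m) x = 0"
proof -
  obtain h :: "rat poly" where "h \<noteq> 0" "poly (map_poly of_rat h) x = 0"
    using assms by (rule algebraic_rat_poly)
  then have "\<exists>m. Factorial_Ring.irreducible m \<and> poly (map_poly of_rat m) x = 0"
  proof (induction h rule: prime_divisors_induct)
    case zero
    then show ?case by simp
  next
    \<comment> \<open>A nonzero constant has no root, so this case is contradictory.\<close>
    case (unit u)
    then obtain c where "u = [:c:]" "c \<noteq> 0"
      by (auto simp: is_unit_iff_degree elim!: degree_eq_zeroE)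
    then show ?case using unit by (simp add: map_poly_pCons)
  next
    case (factor p h)
    interpret map_poly_comm_ring_hom "of_rat :: rat \<Rightarrow> 'a" ..
    show ?case
      using factor by (auto simp: hom_mult dest: prime_elem_imp_irreducible)
  qed
  then show ?thesis using that by blast
qed

text \<open>Converse to \<open>embedding_to_conjugate\<close>: rational coefficients are fixed, so
  roots of the minimal polynomial go to roots.\<close>

lemma field_graph_conjugate:
  assumes "field_graph G" "(x, y) \<in> G" "algebraic x"
  shows "conjugate_over_rat x y"
proof -
  obtain m :: "rat poly" where m: "Factorial_Ring.irreducible m" "poly (map_poly of_rat m) x = 0"
    using assms(3) by (rule algebraic_irreducible_poly)
  then have "poly (map_poly of_rat m) y = 0"
    using field_graph_poly_root_iff[OF assms(1,2)] by simp
  then show ?thesis using m by (auto simp: conjugate_over_rat_def)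
qed

section \<open>Algebraic integers all of whose conjugates are small\<close>

lemma norm_prod_mset_less_one:
  fixes A :: "'a::{real_normed_div_algebra, comm_ring_1} multiset"
  assumes "\<And>a. a \<in># A \<Longrightarrow> norm a < 1" "A \<noteq> {#}"
  shows "norm (prod_mset A) < 1"
  using assms(2,1)
proof (induction A rule: multiset_induct)
  case (add a A)
  then have a: "norm a < 1" by simp
  have "norm (prod_mset A) \<le> 1"
    by (cases "A = {#}") (use add in \<open>auto intro: less_imp_le\<close>)
  then have "norm a * norm (prod_mset A) \<le> norm a" by (intro mult_left_le) auto
  then show ?case using a by (simp add: norm_mult)
qed simp

text \<open>The norm of \<open>\<theta>\<close> over the rationals is an integer, so if all conjugates are small it
  vanishes.\<close>

lemma algebraic_int_eq_0_if_conjugates_small: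
  assumes "algebraic_int \<theta>" and small: "\<And>\<beta>. conjugate_over_rat \<theta> \<beta> \<Longrightarrow> cmod \<beta> < 1"
  shows "\<theta> = 0"
proof -
  obtain m :: "rat poly" where m: "Factorial_Ring.irreducible m" "poly (map_poly of_rat m) \<theta> = 0"
    using assms(1) algebraic_irreducible_poly by blast
  define p where "p = (map_poly of_rat m :: complex poly)"
  \<comment> \<open>Negating the roots absorbs the sign, so the constant coefficient of
    \<open>p\<close> is \<open>lead_coeff p * r\<close>.\<close>
  define r where "r = prod_mset (image_mset uminus (proots p))"
  have p0: "p \<noteq> 0" using m(1) by (auto simp: p_def map_poly_eq_0_iff)
  have conj: "conjugate_over_rat \<theta> \<beta>" if "poly p \<beta> = 0" for \<beta>
    using m that by (auto simp: conjugate_over_rat_def p_def)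
  have "algebraic_int \<beta>" if root: "poly p \<beta> = 0" for \<beta>
  proof -
    obtain G :: "(complex \<times> complex) set" where G: "field_graph G" "(\<theta>, \<beta>) \<in> G"
      using conj[OF root] embedding_to_conjugate by blast
    obtain q where q: "poly (map_poly of_int q) \<theta> = 0" "lead_coeff q = 1"
      using assms(1) by (auto simp: algebraic_int_altdef_ipoly)
    have "poly (map_poly of_int q) \<beta> = 0"
      using field_graph_poly_root_iff[OF G, of "map_poly of_int q"] q(1)
      by (simp add: map_poly_map_poly o_def)
    then show ?thesis using q(2) by (auto simp: algebraic_int_altdef_ipoly)
  qed
  then have "algebraic_int r"
    using p0 unfolding r_def by (intro algebraic_int_prod_mset) auto
  moreover have p_0: "lead_coeff p * r = coeff p 0"
  proof -
    have "coeff p 0 = poly (smult (lead_coeff p) (\<Prod>x\<in>#proots p. [:-x, 1:])) 0"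
      by (simp add: complex_poly_decompose_multiset poly_0_coeff_0)
    then show ?thesis by (simp add: poly_prod_mset r_def image_mset.compositionality o_def)
  qed
  moreover have "r \<in> \<rat>"
  proof -
    have "r = coeff p 0 / lead_coeff p" using p_0 p0 by (simp add: field_simps)
    then show ?thesis by (simp add: p_def coeff_map_poly)
  qed
  ultimately obtain k :: int where k: "r = of_int k"
    using rational_algebraic_int_is_int by (metis Ints_cases)
  \<comment> \<open>At least one root is needed for a strict bound, since the empty product has norm
    1.\<close>
  have "degree p \<noteq> 0" using p0 m(2) by (auto simp: p_def[symmetric] elim!: degree_eq_zeroE)
  then have "proots p \<noteq> {#}" using size_proots_complex[of p] by auto
  then have "cmod r < 1"
    unfolding r_def using p0 by (intro norm_prod_mset_less_one) (auto intro: small[OF conj])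
  then have "r = 0" using k by simp
  \<comment> \<open>Now 0 is itself a conjugate of \<theta>, and embeddings send only 0 to
    0.\<close>
  then have "poly p 0 = 0" using p_0 by (simp add: poly_0_coeff_0)
  then obtain G :: "(complex \<times> complex) set" where "field_graph G" "(\<theta>, 0) \<in> G"
    using conj embedding_to_conjugate by blast
  then show ?thesis using field_graph_eq_0_iff by blast
qed

section \<open>Totally imaginary quadratic extensions\<close>

lemma subfield_complexD:
  assumes "subfield F complex_field"
  shows "0 \<in> F" "1 \<in> F" "x \<in> F \<Longrightarrow> y \<in> F \<Longrightarrow> x + y \<in> F" "x \<in> F \<Longrightarrow> y \<in> F \<Longrightarrow> x * y \<in> F"
    "x \<in> F \<Longrightarrow> - x \<in> F" "x \<in> F \<Longrightarrow> y \<in> F \<Longrightarrow> x - y \<in> F" "x \<in> F \<Longrightarrow> y \<in> F \<Longrightarrow> x / y \<in> F"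
    "numeral k \<in> F"
proof -
  interpret R: field complex_field by (rule field_from_type_algebra)
  have ops [simp]: "\<zero>\<^bsub>complex_field\<^esub> = 0" "\<one>\<^bsub>complex_field\<^esub> = 1" "x \<oplus>\<^bsub>complex_field\<^esub> y = x + y"
    "x \<otimes>\<^bsub>complex_field\<^esub> y = x * y" "carrier complex_field = UNIV" for x y
    by (simp_all add: ring_of_type_algebra_def)
  note ring = subringE[OF subfieldE(1)[OF assms]]
  show zero: "0 \<in> F" and one: "1 \<in> F"
    using ring(2,3) by simp_all
  show add: "x + y \<in> F" if "x \<in> F" "y \<in> F" for x y
    using ring(7)[OF that] by simp
  show mult: "x * y \<in> F" if "x \<in> F" "y \<in> F" for x y
    using ring(6)[OF that] by simp
  show uminus: "- x \<in> F" if "x \<in> F" for x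
    using ring(5)[OF that] R.minus_equality[of "- x" x] by simp
  show "x - y \<in> F" if "x \<in> F" "y \<in> F" for x y
    using add[OF that(1) uminus[OF that(2)]] by simp
  have inverse: "inverse x \<in> F" if "x \<in> F" for x
  \<comment> \<open>The inverse of 0 defaults to 0, so closure under division asks for no nonzero
    denominator.\<close>
  proof (cases "x = 0")
    case False
    then show ?thesis
      using R.subfield_m_inv(1,2)[OF assms, of x] that by (auto simp: inverse_unique)
  qed (simp add: zero)
  show "x / y \<in> F" if "x \<in> F" "y \<in> F" for x y
    using mult[OF that(1) inverse[OF that(2)]] by (simp add: divide_inverse)
  have "of_nat n \<in> F" for n by (induction n) (auto intro: zero one add)
  then show "numeral k \<in> F" by (metis of_nat_numeral)
qed

text \<open>A two-element spanning family is exchanged for one of the form 1, \<open>e\<close>;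
  completing the square then replaces \<open>e\<close> by a square root of an element of
  \<open>K\<close>.\<close>

lemma quadratic_extension_sqrtE:
  assumes "quadratic_extension K L"
  obtains f where "f\<^sup>2 \<in> K" "L = {a + b * f | a b. a \<in> K \<and> b \<in> K}"
proof -
  interpret R: field complex_field by (rule field_from_type_algebra)
  have ops [simp]: "\<zero>\<^bsub>complex_field\<^esub> = 0" "x \<oplus>\<^bsub>complex_field\<^esub> y = x + y"
    "x \<otimes>\<^bsub>complex_field\<^esub> y = x * y" for x y
    by (simp_all add: ring_of_type_algebra_def)
  have "subfield K complex_field" and "subfield L complex_field" and "K \<subseteq> L"
    and dim: "R.dimension (Suc (Suc 0)) K L"
    using assms by (auto simp: quadratic_extension_def numeral_2_eq_2)
  note K = subfield_complexD[OF \<open>subfield K complex_field\<close>]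
  note L = subfield_complexD[OF \<open>subfield L complex_field\<close>]
  obtain v E where E: "R.dimension (Suc 0) K E" "L = R.line_extension K v E"
    using R.dimension_backwards[OF \<open>subfield K complex_field\<close> dim] by blast
  obtain w where "E = R.line_extension K w {0}"
    using R.dimension_backwards[OF \<open>subfield K complex_field\<close> E(1)]
      R.dimension_zero[OF \<open>subfield K complex_field\<close>] by fastforce
  then have "E = (\<lambda>b. b * w) ` K"
    by (simp add: set_eq_iff image_iff R.line_extension_mem_iff)
  then have "x \<in> L \<longleftrightarrow> (\<exists>a\<in>K. \<exists>b\<in>K. x = a * v + b * w)" for x
    unfolding E(2) by (simp add: R.line_extension_mem_iff)
  then have L_eq: "L = {a * v + b * w | a b. a \<in> K \<and> b \<in> K}"
    by blast
  have "\<exists>e. L = {a + b * e | a b. a \<in> K \<and> b \<in> K}"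
  proof -
    obtain a b where ab: "a \<in> K" "b \<in> K" "1 = a * v + b * w"
      using L(2) L_eq by auto
    \<comment> \<open>Exchange step: 1 may replace the generator that occurs in it with nonzero
      coefficient. It is stated for arbitrary \<open>v\<close>, \<open>w\<close> to serve both cases
      below.\<close>
    have reduce: "\<exists>e. L = {a + b * e | a b. a \<in> K \<and> b \<in> K}"
      if "a \<in> K" "b \<in> K" "a \<noteq> 0" "1 = a * v + b * w"
        and L_eq: "L = {a * v + b * w | a b. a \<in> K \<and> b \<in> K}" for a b v w
    proof (intro exI[of _ w] equalityI subsetI)
      fix z assume "z \<in> L"
      then obtain c d where "c \<in> K" "d \<in> K" "z = c * v + d * w" using L_eq by auto
      moreover have "v = (1 - b * w) / a" using that(3,4) by (simp add: field_simps)
      ultimately have "z = c / a + (d - c / a * b) * w"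
        using \<open>a \<noteq> 0\<close> by (simp add: field_simps)
      moreover have "c / a \<in> K" "d - c / a * b \<in> K"
        using that(1,2) \<open>c \<in> K\<close> \<open>d \<in> K\<close> K by simp_all
      ultimately show "z \<in> {a + b * w | a b. a \<in> K \<and> b \<in> K}" by blast
    next
      fix z assume "z \<in> {a + b * w | a b. a \<in> K \<and> b \<in> K}"
      moreover have "w \<in> L"
        using L_eq K(1,2) by (force intro: exI[of _ 0] exI[of _ 1])
      ultimately show "z \<in> L" using \<open>K \<subseteq> L\<close> by (auto intro!: L(3,4))
    qed
    show ?thesis
    proof (cases "a = 0")
      case False
      then show ?thesis using reduce ab L_eq by blast
    next
      case True
      then have "b \<noteq> 0" using ab by auto
      moreover have "L = {a * w + b * v | a b. a \<in> K \<and> b \<in> K}"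
        unfolding L_eq by (metis add.commute)
      ultimately show ?thesis using reduce[of b a w v] ab by (simp add: add.commute)
    qed
  qed
  then obtain e where L_e: "L = {a + b * e | a b. a \<in> K \<and> b \<in> K}" by blast
  have "e \<in> L" using L_e K(1,2) by force
  then have "e * e \<in> L" by (rule L(4)) fact
  then obtain p q where pq: "p \<in> K" "q \<in> K" "e * e = p + q * e" using L_e by auto
  \<comment> \<open>The shift by \<open>q / 2\<close> removes the linear term from
    \<open>e * e = p + q * e\<close>.\<close>
  define f where "f = e - q / 2"
  have "f\<^sup>2 = p + q / 2 * (q / 2)" using pq(3) by (simp add: f_def power2_eq_square algebra_simps)
  then have "f\<^sup>2 \<in> K" using pq K by simp
  moreover have "L = {a + b * f | a b. a \<in> K \<and> b \<in> K}"
  proof (intro equalityI subsetI)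
    fix z assume "z \<in> L"
    then obtain a b where ab: "a \<in> K" "b \<in> K" "z = a + b * e" using L_e by auto
    then have "z = (a + b * (q / 2)) + b * f" by (simp add: f_def algebra_simps)
    moreover have "a + b * (q / 2) \<in> K" using ab pq K by simp
    ultimately show "z \<in> {a + b * f | a b. a \<in> K \<and> b \<in> K}" using ab by blast
  next
    fix z assume "z \<in> {a + b * f | a b. a \<in> K \<and> b \<in> K}"
    then obtain a b where ab: "a \<in> K" "b \<in> K" "z = a + b * f" by auto
    then have "z = (a - b * (q / 2)) + b * e" by (simp add: f_def algebra_simps)
    moreover have "a - b * (q / 2) \<in> K" using ab pq K by simp
    ultimately show "z \<in> L" using ab L_e by blast
  qed
  ultimately show ?thesis by (rule that)
qed

section \<open>Totally real numbers and square roots in \<open>K\<close>\<close>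

lemma totally_real_image:
  fixes G :: "(complex \<times> complex) set"
  assumes "totally_real z" "field_graph G" "(z, z') \<in> G"
  shows "z' \<in> \<real>"
  using field_graph_conjugate[OF assms(2,3)] assms(1) by (auto simp: totally_real_def)

text \<open>An algebraic number is a conjugate of itself, witnessed by its minimal
  polynomial.\<close>

lemma totally_real_imp_real:
  assumes "totally_real z"
  shows "z \<in> \<real>"
proof -
  obtain m :: "rat poly" where "Factorial_Ring.irreducible m" "poly (map_poly of_rat m) z = 0"
    using assms algebraic_irreducible_poly unfolding totally_real_def by blast
  then show ?thesis using assms by (auto simp: totally_real_def conjugate_over_rat_def)
qed

text \<open>A real square means \<open>Re z * Im z = 0\<close>; nonnegativity excludes a nonzero
  purely imaginary \<open>z\<close>.\<close>

lemma real_if_square_nonneg: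
  fixes z :: complex
  assumes "z\<^sup>2 \<in> \<real>" "Re (z\<^sup>2) \<ge> 0"
  shows "z \<in> \<real>"
proof -
  have "Re z * Im z = 0" and le: "(Im z)\<^sup>2 \<le> (Re z)\<^sup>2"
    using assms by (auto simp: complex_is_Real_iff power2_eq_square)
  then have "Im z = 0" by auto
  then show ?thesis by (simp add: complex_is_Real_iff)
qed

lemma algebraic_if_square:
  fixes z :: complex
  assumes "algebraic (z\<^sup>2)"
  shows "algebraic z"
proof -
  have "z = csqrt (z\<^sup>2) \<or> z = - csqrt (z\<^sup>2)"
    by (metis power2_csqrt power2_eq_iff)
  then show ?thesis using algebraic_csqrt[OF assms] by (metis algebraic_minus)
qed

text \<open>Any conjugate of \<open>w\<close> is its image under some embedding, and the square of
  that image is real and nonnegative. So \<open>w\<close> is totally real and the closure hypothesis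
  applies.\<close>

lemma square_root_mem:
  assumes K: "totally_real_field K" "closed_under_square_roots K"
    and "w\<^sup>2 \<in> K"
    and nonneg: "\<And>G z. field_graph G \<Longrightarrow> Collect algebraic \<subseteq> Domain G \<Longrightarrow> (w\<^sup>2, z) \<in> G \<Longrightarrow> Re z \<ge> 0"
  shows "w \<in> K"
proof -
  have tr: "totally_real (w\<^sup>2)" using K(1) \<open>w\<^sup>2 \<in> K\<close> by (simp add: totally_real_field_def)
  then have "algebraic w" by (simp add: totally_real_def algebraic_if_square[of w])
  have "w' \<in> \<real>" if conj: "conjugate_over_rat w w'" for w'
  proof -
    obtain G where G: "field_graph G" "(w, w') \<in> G" "Collect algebraic \<subseteq> Domain G"
      using conj by (rule embedding_to_conjugate)
    have "(w\<^sup>2, w'\<^sup>2) \<in> G"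
      using field_graph_mult[OF G(1,2,2)] by (simp add: power2_eq_square)
    then show ?thesis
      using real_if_square_nonneg[OF totally_real_image[OF tr G(1)] nonneg[OF G(1,3)]] by blast
  qed
  then have "totally_real w" using \<open>algebraic w\<close> by (simp add: totally_real_def)
  then show ?thesis
    using K(2) \<open>algebraic w\<close> \<open>w\<^sup>2 \<in> K\<close> by (auto simp: closed_under_square_roots_def algebraic_numbers_def)
qed

section \<open>The shape of the totally imaginary extension\<close>

text \<open>Choosing images and taking real parts would turn such a graph into a ring homomorphism
  from \<open>L\<close> to the reals.\<close>

lemma totally_imaginary_no_real_graph:
  fixes G :: "(complex \<times> complex) set"
  assumes L: "totally_imaginary_field L" and G: "field_graph G"
    and real: "\<And>x. x \<in> L \<Longrightarrow> \<exists>y\<in>\<real>. (x, y) \<in> G"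
  shows False
proof -
  obtain h where h: "\<And>x. x \<in> L \<Longrightarrow> h x \<in> \<real> \<and> (x, h x) \<in> G"
    using real by metis
  note F = subfield_complexD[of L]
  have sub: "subfield L complex_field" using L by (simp add: totally_imaginary_field_def)
  have unique: "h x = y" if "x \<in> L" "(x, y) \<in> G" for x y
    using field_graph_unique[OF G] h that by blast
  have "(\<lambda>x. Re (h x)) \<in> Ring.ring_hom (complex_field\<lparr>carrier := L\<rparr>) real_field"
  proof (rule ring_hom_memI)
    fix x y assume "x \<in> carrier (complex_field\<lparr>carrier := L\<rparr>)" "y \<in> carrier (complex_field\<lparr>carrier := L\<rparr>)"
    then have xy: "x \<in> L" "y \<in> L" by auto
    have "h (x * y) = h x * h y"
      using h xy F[OF sub] by (intro unique field_graph_mult[OF G]) auto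
    then show "Re (h (x \<otimes>\<^bsub>complex_field\<lparr>carrier := L\<rparr>\<^esub> y)) = Re (h x) \<otimes>\<^bsub>real_field\<^esub> Re (h y)"
      using h[OF xy(1)] by (auto simp: ring_of_type_algebra_def complex_is_Real_iff)
    have "h (x + y) = h x + h y"
      using h xy F[OF sub] by (intro unique field_graph_add[OF G]) auto
    then show "Re (h (x \<oplus>\<^bsub>complex_field\<lparr>carrier := L\<rparr>\<^esub> y)) = Re (h x) \<oplus>\<^bsub>real_field\<^esub> Re (h y)"
      by (simp add: ring_of_type_algebra_def)
  next
    have "h 1 = 1" using F[OF sub] by (intro unique field_graph_one[OF G])
    then show "Re (h \<one>\<^bsub>complex_field\<lparr>carrier := L\<rparr>\<^esub>) = \<one>\<^bsub>real_field\<^esub>"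
      by (simp add: ring_of_type_algebra_def)
  qed (simp add: ring_of_type_algebra_def)
  then show False using L by (simp add: totally_imaginary_field_def)
qed

text \<open>Write \<open>L\<close> as \<open>K\<close> with a square root \<open>f\<close> adjoined.
  Every embedding makes \<open>f^2\<close> negative, so \<open>- (f^2)\<close> has a square root
  \<open>w\<close> in \<open>K\<close>, and \<open>f / w\<close> is \<open>\<i>\<close> or its
  negative.\<close>

lemma totally_imaginary_quadratic_eq_adjoin_i:
  assumes K: "totally_real_field K" "closed_under_square_roots K"
    and "quadratic_extension K L" "totally_imaginary_field L"
  shows "L = {a + b * \<i> | a b. a \<in> K \<and> b \<in> K}"
proof -
  have subK: "subfield K complex_field" using K(1) by (simp add: totally_real_field_def)
  note F = subfield_complexD[OF subK]
  obtain f where f: "f\<^sup>2 \<in> K" "L = {a + b * f | a b. a \<in> K \<and> b \<in> K}"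
    using assms(3) by (rule quadratic_extension_sqrtE)
  have tr: "totally_real a" if "a \<in> K" for a
    using K(1) that by (simp add: totally_real_field_def)
  have "algebraic f" using tr[OF f(1)] by (simp add: totally_real_def algebraic_if_square[of f])
  \<comment> \<open>Otherwise the image of \<open>f\<close> is real, and the embedding maps all of
    \<open>L\<close> into the reals.\<close>
  have negative: "Re z < 0"
    if G: "field_graph G" "Collect algebraic \<subseteq> Domain G" "(f\<^sup>2, z) \<in> G" for G z
  proof (rule ccontr)
    assume "\<not> Re z < 0"
    obtain f' where f': "(f, f') \<in> G" using G(2) \<open>algebraic f\<close> by blast
    have "(f\<^sup>2, f'\<^sup>2) \<in> G"
      using field_graph_mult[OF G(1) f' f'] by (simp add: power2_eq_square)
    then have "f'\<^sup>2 = z" using field_graph_unique[OF G(1)] G(3) by blast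
    then have "f' \<in> \<real>"
      using totally_real_image[OF tr[OF f(1)] G(1,3)] \<open>\<not> Re z < 0\<close>
      by (simp add: real_if_square_nonneg[of f'])
    have "\<exists>y\<in>\<real>. (x, y) \<in> G" if "x \<in> L" for x
    proof -
      obtain a b where ab: "a \<in> K" "b \<in> K" "x = a + b * f" using f(2) \<open>x \<in> L\<close> by auto
      have "algebraic a" "algebraic b" using tr ab(1,2) by (auto simp: totally_real_def)
      then obtain a' b' where G': "(a, a') \<in> G" "(b, b') \<in> G"
        using G(2) by blast
      have "a' \<in> \<real>" "b' \<in> \<real>"
        using totally_real_image[OF tr G(1)] ab(1,2) G' by auto
      then have "a' + b' * f' \<in> \<real>" using \<open>f' \<in> \<real>\<close> by simp
      moreover have "(x, a' + b' * f') \<in> G"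
        unfolding ab(3) by (intro field_graph_add[OF G(1)] field_graph_mult[OF G(1)] G' f')
      ultimately show ?thesis by blast
    qed
    then show False using totally_imaginary_no_real_graph[OF assms(4) G(1)] by blast
  qed
  define w where "w = csqrt (- (f\<^sup>2))"
  have w2: "w\<^sup>2 = - (f\<^sup>2)" by (simp add: w_def)
  have "w \<in> K"
  proof (rule square_root_mem[OF K])
    show "w\<^sup>2 \<in> K" unfolding w2 by (intro F f)
  next
    fix G :: "(complex \<times> complex) set" and z assume G: "field_graph G" "Collect algebraic \<subseteq> Domain G" "(w\<^sup>2, z) \<in> G"
    then have "(f\<^sup>2, - z) \<in> G" using field_graph_uminus[OF G(1,3)] w2 by simp
    then show "0 \<le> Re z" using negative[OF G(1,2)] by fastforce
  qed
  \<comment> \<open>Some embedding exists, and under it \<open>f = 0\<close> would make 0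
    negative.\<close>
  obtain G :: "(complex \<times> complex) set" where "field_graph G" "Collect algebraic \<subseteq> Domain G"
    by (rule field_graph_extend_algebraic[OF field_graph_rat])
  then have "f \<noteq> 0" using negative[of G 0] field_graph_zero[of G] by auto
  then have "w \<noteq> 0" using w2 by auto
  have "(f / w)\<^sup>2 = \<i>\<^sup>2" using w2 \<open>f \<noteq> 0\<close> by (simp add: power_divide)
  then have "f / w = \<i> \<or> f / w = - \<i>" by (simp only: power2_eq_iff)
  then have "f = w * \<i> \<or> f = - w * \<i>" using \<open>w \<noteq> 0\<close> by (auto simp: field_simps)
  then obtain v where v: "v \<in> K" "v \<noteq> 0" "f = v * \<i>"
    using \<open>w \<in> K\<close> \<open>w \<noteq> 0\<close> F(5)[of w] by (metis neg_equal_0_iff_equal)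
  show ?thesis
  proof (intro equalityI subsetI)
    fix z assume "z \<in> L"
    then obtain a b where "a \<in> K" "b \<in> K" "z = a + b * v * \<i>" using f(2) v(3) by (auto simp: mult.assoc)
    moreover from this have "b * v \<in> K" using v(1) by (intro F(4))
    ultimately show "z \<in> {a + b * \<i> | a b. a \<in> K \<and> b \<in> K}" by blast
  next
    fix z assume "z \<in> {a + b * \<i> | a b. a \<in> K \<and> b \<in> K}"
    then obtain a b where ab: "a \<in> K" "b \<in> K" "z = a + b * \<i>" by auto
    then have "z = a + (b / v) * f" using v by simp
    moreover have "b / v \<in> K" using ab(2) v(1) by (rule F(7))
    ultimately show "z \<in> L" using f(2) ab(1) by blast
  qed
qed

section \<open>Units congruent to 1 modulo 4\<close>

text \<open>Images of \<open>K\<close> stay real and \<open>\<i>\<close> goes to a square root of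
  -1, so embeddings commute with complex conjugation on \<open>K(\<i>)\<close>. The bound on
  \<theta> therefore holds for all its conjugates.\<close>

lemma unit_cong_1_mod_4_mem:
  assumes K: "totally_real_field K" and s: "s \<in> {a + b * \<i> | a b. a \<in> K \<and> b \<in> K}"
    and int: "algebraic_int s" "algebraic_int u'" and unit: "(1 + 4 * s) * u' = 1"
  shows "s \<in> K"
proof -
  obtain a b where ab: "a \<in> K" "b \<in> K" "s = a + b * \<i>" using s by auto
  have tr: "totally_real a" "totally_real b" using K ab by (auto simp: totally_real_field_def)
  then have real: "a \<in> \<real>" "b \<in> \<real>" by (auto intro: totally_real_imp_real)
  define r where "r = a - b * \<i>"
  have r: "cnj s = r"
    using real by (auto simp: r_def ab complex_eq_iff complex_is_Real_iff)
  \<comment> \<open>The product form shows integrality; the quotient form below lets images under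
    embeddings be computed.\<close>
  define \<theta> where "\<theta> = (s - r) * cnj u'"
  have cnj_unit: "(1 + 4 * r) * cnj u' = 1"
    using arg_cong[OF unit, of cnj] by (simp add: r)
  have "\<theta> * (1 + 4 * r) = (s - r) * ((1 + 4 * r) * cnj u')"
    by (simp only: \<theta>_def mult_ac)
  then have \<theta>_eq: "\<theta> = (s - r) / (1 + 4 * r)"
    using cnj_unit by (auto simp: eq_divide_eq)
  have "\<theta> = 0"
  proof (rule algebraic_int_eq_0_if_conjugates_small)
    show "algebraic_int \<theta>"
      unfolding \<theta>_def r[symmetric] using int by (intro algebraic_int_mult algebraic_int_diff) auto
  next
    fix \<theta>' assume "conjugate_over_rat \<theta> \<theta>'"
    then obtain G where G: "field_graph G" "(\<theta>, \<theta>') \<in> G" "Collect algebraic \<subseteq> Domain G"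
      by (rule embedding_to_conjugate)
    obtain a' b' i' where G': "(a, a') \<in> G" "(b, b') \<in> G" "(\<i>, i') \<in> G"
      using G(3) tr algebraic_ii unfolding totally_real_def by (metis DomainE mem_Collect_eq subsetD)
    have real': "a' \<in> \<real>" "b' \<in> \<real>"
      using totally_real_image[OF tr(1) G(1) G'(1)] totally_real_image[OF tr(2) G(1) G'(2)] .
    have "(\<i> * \<i>, i' * i') \<in> G" by (intro field_graph_mult[OF G(1)] G')
    moreover have "(- 1, - 1) \<in> G" by (intro field_graph_uminus[OF G(1)] field_graph_one[OF G(1)])
    ultimately have "i' * i' = - 1" using field_graph_unique[OF G(1), of "- 1"] by simp
    then have "i'\<^sup>2 = \<i>\<^sup>2" by (simp add: power2_eq_square)
    then have "i' = \<i> \<or> i' = - \<i>" by (simp only: power2_eq_iff)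
    then have cnj_i': "cnj i' = - i'" by auto
    define s' where "s' = a' + b' * i'"
    define r' where "r' = a' - b' * i'"
    have r': "cnj s' = r'"
      using real' cnj_i' by (simp add: s'_def r'_def Reals_cnj_iff)
    have four: "(4, 4) \<in> G" using field_graph_of_nat[OF G(1), of 4] by simp
    have sr: "(s, s') \<in> G" "(r, r') \<in> G"
      unfolding s'_def r'_def r_def ab(3)
      by (intro field_graph_add[OF G(1)] field_graph_diff[OF G(1)] field_graph_mult[OF G(1)] G')+
    have denom: "(1 + 4 * r, 1 + 4 * r') \<in> G"
      by (intro field_graph_add[OF G(1)] field_graph_mult[OF G(1)] field_graph_one[OF G(1)] four sr)
    then have nz: "1 + 4 * r' \<noteq> 0"
      using field_graph_eq_0_iff[OF G(1) denom] cnj_unit by auto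
    have "(\<theta>, (s' - r') / (1 + 4 * r')) \<in> G"
      unfolding \<theta>_eq by (intro field_graph_divide[OF G(1)] field_graph_diff[OF G(1)] sr denom)
    then have \<theta>': "\<theta>' = (s' - r') / (1 + 4 * r')" using field_graph_unique[OF G(1,2)] by blast
    have "1 + 4 * r' = cnj (1 + 4 * s')" by (simp add: r')
    then have "cmod (1 + 4 * r') = cmod (1 + 4 * s')" by (simp only: complex_mod_cnj)
    \<comment> \<open>Four times the numerator is the difference of \<open>1 + 4 * s'\<close> and
      \<open>1 + 4 * r'\<close>, which have equal modulus.\<close>
    moreover have "cmod (4 * (s' - r')) \<le> cmod (1 + 4 * s') + cmod (1 + 4 * r')"
      using norm_triangle_ineq4[of "1 + 4 * s'" "1 + 4 * r'"] by (simp add: right_diff_distrib)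
    moreover have "cmod (4 * (s' - r')) = 4 * cmod (s' - r')"
      by (simp only: norm_mult norm_numeral)
    ultimately have "4 * cmod (s' - r') \<le> 2 * cmod (1 + 4 * r')" by linarith
    moreover have "0 < cmod (1 + 4 * r')" using nz by simp
    ultimately have "cmod (s' - r') < cmod (1 + 4 * r')" by linarith
    then show "cmod \<theta>' < 1" using nz by (simp add: \<theta>' norm_divide divide_less_eq)
  qed
  \<comment> \<open>Since \<open>cnj u'\<close> is nonzero, \<open>s\<close> equals its complex
    conjugate, and its imaginary part \<open>b\<close> drops out.\<close>
  then have "s = r" using cnj_unit by (auto simp: \<theta>_def)
  then have "s = a" by (simp add: r_def ab)
  then show ?thesis using ab by simp
qed

lemma unit_with_trace:
  assumes K: "totally_real_field K" "closed_under_square_roots K"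
    and x: "x \<in> K" "algebraic_int x"
  obtains s u where "s \<in> K" "algebraic_int s" "u \<in> K" "algebraic_int u"
    "(1 + 4 * s) * u = 1" "(1 + 4 * s) + u = 2 + 16 * x\<^sup>2"
proof -
  have subK: "subfield K complex_field" using K(1) by (simp add: totally_real_field_def)
  note F = subfield_complexD[OF subK]
  have tr: "totally_real x" using K(1) x by (simp add: totally_real_field_def)
  \<comment> \<open>Under every embedding \<open>x\<close> becomes real, so
    \<open>4 * (x * x) + 1\<close> becomes positive and its root lies in \<open>K\<close>.\<close>
  define w where "w = csqrt (4 * (x * x) + 1)"
  have w2: "w\<^sup>2 = 4 * (x * x) + 1" by (simp add: w_def)
  have wK: "w \<in> K"
  proof (rule square_root_mem[OF K])
    show "w\<^sup>2 \<in> K" unfolding w2 by (intro F x)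
  next
    fix G :: "(complex \<times> complex) set" and z assume G: "field_graph G" "Collect algebraic \<subseteq> Domain G" "(w\<^sup>2, z) \<in> G"
    obtain x' where x': "(x, x') \<in> G" using G(2) tr unfolding totally_real_def by blast
    have four: "(4, 4) \<in> G" using field_graph_of_nat[OF G(1), of 4] by simp
    have "(w\<^sup>2, 4 * (x' * x') + 1) \<in> G"
      unfolding w2
      by (intro field_graph_add[OF G(1)] field_graph_mult[OF G(1)] field_graph_one[OF G(1)] four x')
    then have "z = 4 * (x' * x') + 1" using field_graph_unique[OF G(1,3)] by blast
    moreover have "x' \<in> \<real>" using totally_real_image[OF tr G(1) x'] .
    ultimately show "0 \<le> Re z" by (simp add: complex_is_Real_iff)
  qed
  have num: "algebraic_int (numeral k :: complex)" for k by (intro int_imp_algebraic_int) simp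
  have w_int: "algebraic_int w"
    unfolding w_def using x(2) by (intro algebraic_int_csqrt algebraic_int_add algebraic_int_mult num)
      (auto intro: int_imp_algebraic_int)
  show ?thesis
  \<comment> \<open>As \<open>w^2 - 4 * x^2 = 1\<close>, the numbers \<open>w + 2 * x\<close> and
    \<open>w - 2 * x\<close> are inverse units. Squaring the first gives \<open>1 + 4 * s\<close>
    with \<open>s = x * (2 * x + w)\<close>; \<open>u\<close> is the square of the second.\<close>
  proof (rule that[of "x * (2 * x + w)" "(w - 2 * x) * (w - 2 * x)"])
    show "x * (2 * x + w) \<in> K" "(w - 2 * x) * (w - 2 * x) \<in> K"
      by (intro F x wK)+
    show "algebraic_int (x * (2 * x + w))" "algebraic_int ((w - 2 * x) * (w - 2 * x))"
      by (intro algebraic_int_add algebraic_int_diff algebraic_int_mult num x w_int)+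
    have "1 + 4 * (x * (2 * x + w)) = (2 * x + w)\<^sup>2"
      using w2 by (simp add: power2_eq_square algebra_simps)
    moreover have "(2 * x + w) * (w - 2 * x) = 1"
      using w2 by (simp add: power2_eq_square algebra_simps)
    ultimately show "(1 + 4 * (x * (2 * x + w))) * ((w - 2 * x) * (w - 2 * x)) = 1"
      by (metis mult.assoc mult.left_commute mult_1 power2_eq_square)
    show "1 + 4 * (x * (2 * x + w)) + (w - 2 * x) * (w - 2 * x) = 2 + 16 * x\<^sup>2"
      using w2 by (simp add: power2_eq_square algebra_simps)
  qed
qed

section \<open>The existential formula and its evaluation\<close>

theorem theorem3p4:
  fixes K L :: "complex set"
  assumes "K \<subseteq> algebraic_numbers"
    and "totally_real_field K"
    and "closed_under_square_roots K"
    and "quadratic_extension K L"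
    and "totally_imaginary_field L"
  shows "existentially_definable (integer_ring L) (ring_of_integers K)"
proof -
  have "subfield K complex_field" and KL: "K \<subseteq> L"
    using assms(4) by (auto simp: quadratic_extension_def)
  note F = subfield_complexD[OF this(1)]
  have L: "L = {a + b * \<i> | a b. a \<in> K \<and> b \<in> K}"
    using assms by (intro totally_imaginary_quadratic_eq_adjoin_i)
  define two where "two = RAdd ROne ROne"
  define four where "four = RMul two two"
  define U where "U = (\<lambda>i. RAdd ROne (RMul four (RVar i)))"
  \<comment> \<open>Variable 0 is \<open>x\<close>; variables 1 and 3 are \<open>s\<close> and
    \<open>t\<close> in the units \<open>1 + 4 * s\<close> and \<open>1 + 4 * t\<close>, with
    inverses in 2 and 4. The second trace is moved to the left to avoid a subtraction, and 16 is
    \<open>four\<close> times \<open>four\<close>.\<close>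
  define \<phi> where "\<phi> = REx 1 (REx 2 (REx 3 (REx 4
    (RAnd (REq (RMul (U 1) (RVar 2)) ROne)
    (RAnd (REq (RMul (U 3) (RVar 4)) ROne)
      (REq (RAdd (RMul (RMul four four) (RAdd (RMul two (RVar 0)) ROne)) (RAdd (U 3) (RVar 4)))
        (RAdd (U 1) (RVar 2))))))))"
  have "existential \<phi>"
    unfolding \<phi>_def by (intro existential.intros) simp
  moreover have "free_vars \<phi> \<subseteq> {0}"
    by (auto simp: \<phi>_def U_def four_def two_def)
  moreover have "x \<in> ring_of_integers K \<longleftrightarrow>
    x \<in> carrier (integer_ring L) \<and> holds (integer_ring L) (\<lambda>_. x) \<phi>" for x
  proof -
    define D where "D \<longleftrightarrow> (\<exists>s\<in>ring_of_integers L. \<exists>u\<in>ring_of_integers L.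
      \<exists>t\<in>ring_of_integers L. \<exists>v\<in>ring_of_integers L.
        (1 + 4 * s) * u = 1 \<and> (1 + 4 * t) * v = 1 \<and>
        16 * (2 * x + 1) + ((1 + 4 * t) + v) = (1 + 4 * s) + u)"
    have "holds (integer_ring L) (\<lambda>_. x) \<phi> \<longleftrightarrow> D"
      by (simp add: \<phi>_def U_def four_def two_def D_def integer_ring_def ring_of_type_algebra_def)
    moreover have "x \<in> ring_of_integers K \<longleftrightarrow> x \<in> ring_of_integers L \<and> D"
    proof
      assume "x \<in> ring_of_integers K"
      then have x: "x \<in> K" "algebraic_int x" by (auto simp: ring_of_integers_def)
      obtain t v where tv: "t \<in> K" "algebraic_int t" "v \<in> K" "algebraic_int v"
        "(1 + 4 * t) * v = 1" "(1 + 4 * t) + v = 2 + 16 * x\<^sup>2"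
        by (rule unit_with_trace[OF assms(2,3) x])
      \<comment> \<open>Traces for the consecutive integers \<open>x\<close> and
        \<open>x + 1\<close> turn a difference of squares into an expression linear in
        \<open>x\<close>.\<close>
      have "x + 1 \<in> K" "algebraic_int (x + 1)"
        using x F(2,3) by (auto intro: algebraic_int_add int_imp_algebraic_int)
      then obtain s u where su: "s \<in> K" "algebraic_int s" "u \<in> K" "algebraic_int u"
        "(1 + 4 * s) * u = 1" "(1 + 4 * s) + u = 2 + 16 * (x + 1)\<^sup>2"
        by (rule unit_with_trace[OF assms(2,3)])
      have "16 * (2 * x + 1) + ((1 + 4 * t) + v) = (1 + 4 * s) + u"
        unfolding su(6) tv(6) by (simp add: power2_eq_square algebra_simps)
      moreover have "{s, u, t, v} \<subseteq> ring_of_integers L"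
        using su tv KL by (auto simp: ring_of_integers_def)
      ultimately have D using su(5) tv(5) unfolding D_def by blast
      then show "x \<in> ring_of_integers L \<and> D" using x KL by (auto simp: ring_of_integers_def)
    next
      assume "x \<in> ring_of_integers L \<and> D"
      then obtain s u t v where int: "algebraic_int x" "algebraic_int s" "algebraic_int u"
        "algebraic_int t" "algebraic_int v" and "s \<in> L" "t \<in> L"
        and su: "(1 + 4 * s) * u = 1" and tv: "(1 + 4 * t) * v = 1"
        and eq: "16 * (2 * x + 1) + ((1 + 4 * t) + v) = (1 + 4 * s) + u"
        unfolding D_def ring_of_integers_def by blast
      have "s \<in> K" "t \<in> K"
        using unit_cong_1_mod_4_mem[OF assms(2)] int su tv \<open>s \<in> L\<close> \<open>t \<in> L\<close> unfolding L by blast+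
      have inv: "u = 1 / (1 + 4 * s)" "v = 1 / (1 + 4 * t)"
        using su tv by (auto simp: eq_divide_eq mult.commute)
      \<comment> \<open>The units and their inverses lie in \<open>K\<close>, so solving the linear
        equation puts \<open>x\<close> in \<open>K\<close>; its integrality was assumed.\<close>
      have "x = (((1 + 4 * s) + 1 / (1 + 4 * s) - ((1 + 4 * t) + 1 / (1 + 4 * t))) / 16 - 1) / 2"
        using eq unfolding inv[symmetric] by (simp add: field_simps)
      also have "\<dots> \<in> K" using \<open>s \<in> K\<close> \<open>t \<in> K\<close> by (intro F)
      finally show "x \<in> ring_of_integers K" using int(1) by (simp add: ring_of_integers_def)
    qed
    ultimately show ?thesis by (simp add: integer_ring_def)
  qed
  ultimately show ?thesis
    unfolding existentially_definable_def by (intro exI[of _ \<phi>]) auto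
qed

end
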